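(* Let $s\ge 3$, and let $A\subseteq\mathbb{Z}_s^n$ with $\Pr_{x\sim\mathbb{Z}_s^n}[x\in A]=\delta$. Then for any $\nu\in[1/32,1]$ (with $\nu n$ an integer), $$\Pr_{x\sim\mathbb{Z}_s^n,\ y\sim S_\nu(x)}[x\in A\text{ and }y\in A]\le 2\,\delta^{1+\lambda},$$ where $\lambda=\frac{1}{2^{14}\log s}$.
   Context: $x$ is uniform on $\mathbb{Z}_s^n$. For $x\in\mathbb{Z}_s^n$ and $\nu\in[0,1]$ with $\nu n\in\mathbb{Z}$, the spherical noise distribution $S_\nu(x)$ is obtained by choosing a uniformly random subset $J\subseteq[n]$ of size exactly $\nu n$, keeping the coordinates of $x$ outside $J$, and replacing each coordinate in $J$ (independently) by a uniformly random value of $\mathbb{Z}_s$ different from the current one. *)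

theory Defs
  imports "HOL-Probability.Probability" "HOL-Probability.Product_PMF"
begin

(* Only the underlying set of Z_s matters here, so residues are represented by 0, ..., s - 1 and
   the coordinate set [n] by 0, ..., n - 1.  Points are extensional functions, so that the set
   has exactly s^n elements. *)
definition Zs_pow :: "nat \<Rightarrow> nat \<Rightarrow> (nat \<Rightarrow> nat) set" where
  "Zs_pow s n = ({..<n} \<rightarrow>\<^sub>E {..<s})"

(* Intended for 0 <= \<nu> <= 1 with \<nu> * n an integer, x in Zs_pow s n and s >= 2; otherwise a
   pmf_of_set below may be applied to an empty set and the value is meaningless.
   The default value undefined of Pi_pmf makes the samples extensional outside [n]. *)
definition spherical_noise :: "nat \<Rightarrow> nat \<Rightarrow> real \<Rightarrow> (nat \<Rightarrow> nat) \<Rightarrow> (nat \<Rightarrow> nat) pmf" where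
  "spherical_noise s n \<nu> x =
     do {
       J \<leftarrow> pmf_of_set {J. J \<subseteq> {..<n} \<and> real (card J) = \<nu> * real n};
       Pi_pmf {..<n} undefined
         (\<lambda>i. if i \<in> J then pmf_of_set ({..<s} - {x i}) else return_pmf (x i))
     }"

definition noisy_pair :: "nat \<Rightarrow> nat \<Rightarrow> real \<Rightarrow> ((nat \<Rightarrow> nat) \<times> (nat \<Rightarrow> nat)) pmf" where
  "noisy_pair s n \<nu> =
     do {
       x \<leftarrow> pmf_of_set (Zs_pow s n);
       y \<leftarrow> spherical_noise s n \<nu> x;
       return_pmf (x, y)
     }"

end

theory Submission
  imports Defs "HOL-Combinatorics.Permutations"
begin

text \<open>
  Let k = \<nu> n be the number of changed coordinates, so n \<le> 32 k, and cut the coordinate set into k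
  blocks of size at most 32.  A uniformly random k-subset is the image, under a uniformly random
  permutation, of a random transversal of the blocks.  For a fixed partition into blocks the noise is
  a product over the blocks, each factor changing exactly one random coordinate of its block, so a
  two-function bound E f(x) g(y) \<le> |f|_p |g|_p with p = 2 / (1 + \<lambda>) tensorises from a single block,
  and f = g = 1_A gives \<delta> powr (2 / p) = \<delta> powr (1 + \<lambda>).

  On one block of m coordinates with N = s^m points, s \<ge> 3 keeps the eigenvalue -1 / (s - 1) of a
  forced change away from -1, and together with the Efron-Stein inequality this bounds E f(x) g(y) by the
  mean over h = f, g of (1 - 1/(2m)) E h^2 + (1/(2m)) (E h)^2.  The latter is at most |h|_p^2 because
  t^p \<ge> 1 + p (t - 1) + p (p - 1) / 2 * N^(p - 2) (t - 1)^2 on [0, N], the range of h / E h, and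
  (2 - p) ln N is small compared with 1 / (2m).
\<close>

section \<open>Comparing the second moment with an Lp norm\<close>

text \<open>Subtracting \<open>c * (u - 1)\<^sup>2\<close> from \<open>u powr p\<close> leaves a
  convex function: since \<open>p \<le> 2\<close>, the second derivative of the power is least at
  the right end \<open>N\<close>, and the bound on \<open>c\<close> is calibrated there. A convex
  function lies above its tangent at 1. The interval \<open>{0<..N}\<close> omits 0, where the
  derivatives may fail to exist.\<close>

lemma powr_quadratic_lower_bound:
  fixes p N t c :: real
  assumes p: "1 < p" "p \<le> 2" and N: "1 \<le> N" and t: "0 \<le> t" "t \<le> N"
    and c: "0 \<le> c" "c \<le> p * (p - 1) / 2 * N powr (p - 2)"
  shows "1 + p * (t - 1) + c * (t - 1)\<^sup>2 \<le> t powr p"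
proof (cases "t = 0")
  \<comment> \<open>At \<open>t = 0\<close> the claim is \<open>c \<le> p - 1\<close>, which follows
    from \<open>N powr (p - 2) \<le> 1\<close> and \<open>p / 2 \<le> 1\<close>.\<close>
  case True
  have "N powr (p - 2) \<le> 1"
    using powr_mono2'[of "2 - p" 1 N] p N powr_mono[of "p - 2" 0 N] by simp
  then have "p * (p - 1) / 2 * N powr (p - 2) \<le> p * (p - 1) / 2 * 1"
    using p by (intro mult_left_mono) auto
  also have "\<dots> \<le> p - 1"
    using p mult_right_mono[of p 2 "p - 1"] by simp
  finally show ?thesis
    using True c by simp
next
  case False
  define h where "h = (\<lambda>u. u powr p - c * (u - 1)\<^sup>2)"
  define h' where "h' = (\<lambda>u. p * u powr (p - 1) - 2 * c * (u - 1))"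
  have "h' 1 * (t - 1) \<le> h t - h 1"
  proof (rule f''_imp_f'[where C = "{0<..N}" and f'' = "\<lambda>u. p * (p - 1) * u powr (p - 2) - 2 * c"])
    show "convex {0<..N}" by simp
    show "DERIV h u :> h' u" if "u \<in> {0<..N}" for u
      using that unfolding h_def h'_def
      by (auto intro!: derivative_eq_intros simp: powr_diff field_simps power2_eq_square)
    show "DERIV h' u :> p * (p - 1) * u powr (p - 2) - 2 * c" if "u \<in> {0<..N}" for u
      using that unfolding h'_def
      by (auto intro!: derivative_eq_intros simp: diff_diff_eq)
    show "0 \<le> p * (p - 1) * u powr (p - 2) - 2 * c" if "u \<in> {0<..N}" for u
    proof -
      have "N powr (p - 2) \<le> u powr (p - 2)"
        using that p by (intro powr_mono2') auto
      then have "p * (p - 1) / 2 * N powr (p - 2) \<le> p * (p - 1) / 2 * u powr (p - 2)"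
        using p by (intro mult_left_mono) auto
      then show ?thesis using c by simp
    qed
  qed (use False t N in auto)
  then show ?thesis
    by (simp add: h_def h'_def)
qed

text \<open>Bernoulli's inequality for exponents in [0, 1], read off from weighted AM-GM for
  \<open>1 + x\<close> and 1.\<close>

lemma powr_le_linear:
  fixes x q :: real
  assumes "0 \<le> x" "0 \<le> q" "q \<le> 1"
  shows "(1 + x) powr q \<le> 1 + q * x"
  using Youngs_inequality_0[of q "1 - q" "1 + x" 1] assms by (simp add: algebra_simps)

text \<open>Both sides are homogeneous of degree two, so \<open>f\<close> may be divided by its
  mean. The quotient \<open>t\<close> has mean 1, and averaging the pointwise quadratic bound
  compares its p-th moment with its variance; Bernoulli with exponent \<open>p / 2\<close> then
  brings in the power \<open>2 / p\<close>. The factor \<open>real (card X) powr (1 - 2 / p)\<close>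
  converts averages to sums.\<close>

lemma quadratic_form_le_lp:
  fixes f :: "'a \<Rightarrow> real" and p \<gamma> :: real
  assumes X: "finite X" "X \<noteq> {}" and f: "\<And>x. x \<in> X \<Longrightarrow> 0 \<le> f x"
    and p: "1 < p" "p \<le> 2" and \<gamma>: "\<gamma> \<le> 1"
    and gap: "1 - \<gamma> \<le> (p - 1) * real (card X) powr (p - 2)"
  shows "(1 - \<gamma>) * (\<Sum>x\<in>X. (f x)\<^sup>2) + \<gamma> * (\<Sum>x\<in>X. f x)\<^sup>2 / real (card X)
    \<le> real (card X) powr (1 - 2 / p) * (\<Sum>x\<in>X. f x powr p) powr (2 / p)"
proof (cases "(\<Sum>x\<in>X. f x) = 0")
  case True
  then have "\<And>x. x \<in> X \<Longrightarrow> f x = 0"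
    using X f by (simp add: sum_nonneg_eq_0_iff)
  then show ?thesis by simp
next
  case False
  define N where "N = real (card X)"
  define S where "S = (\<Sum>x\<in>X. f x)"
  define m where "m = S / N"
  define t where "t = (\<lambda>x. f x / m)"
  have N1: "1 \<le> N"
    using X by (simp add: N_def Suc_leI card_gt_0_iff)
  have S: "S > 0"
    using False f by (simp add: S_def sum_nonneg order_less_le)
  have m: "m > 0"
    using S N1 by (simp add: m_def)
  \<comment> \<open>A nonnegative function never exceeds its sum, which is \<open>N\<close> times
    its mean; this supplies the range in which the quadratic bound is valid.\<close>
  have t: "0 \<le> t x \<and> t x \<le> N" if "x \<in> X" for x
  proof -
    have "f x \<le> S"
      using X f that unfolding S_def by (intro member_le_sum) auto
    then show ?thesis
      using f[OF that] m S N1 by (simp add: t_def m_def field_simps)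
  qed
  define W where "W = (\<Sum>x\<in>X. (t x)\<^sup>2)"
  define P where "P = (\<Sum>x\<in>X. t x powr p)"
  have "(\<Sum>x\<in>X. t x) = S / m"
    by (simp add: t_def S_def sum_divide_distrib)
  then have st: "(\<Sum>x\<in>X. t x) = N"
    using S N1 by (simp add: m_def)
  have "(\<Sum>x\<in>X. (t x - 1)\<^sup>2) = W - N"
    using st by (simp add: power2_diff sum.distrib sum_subtractf W_def flip: sum_distrib_left N_def)
  then have V: "W - N \<ge> 0"
    by (metis sum_nonneg zero_le_power2)
  \<comment> \<open>The factor \<open>p / 2\<close> is the one that Bernoulli absorbs, leaving
    exactly \<open>1 - \<gamma>\<close>; the hypothesis \<open>gap\<close> says that this
    \<open>c\<close> is admissible.\<close>
  define c where "c = (1 - \<gamma>) * p / 2"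
  \<comment> \<open>The linear term of the pointwise bound sums to zero because \<open>t\<close> has
    mean 1.\<close>
  have "N + c * (W - N) = (\<Sum>x\<in>X. 1 + p * (t x - 1) + c * (t x - 1)\<^sup>2)"
    using st \<open>_ = W - N\<close>
    by (simp add: sum.distrib flip: sum_distrib_left N_def) (simp add: sum_subtractf flip: N_def)
  also have "\<dots> \<le> P"
    unfolding P_def
  proof (intro sum_mono powr_quadratic_lower_bound[where N = N])
    show "c \<le> p * (p - 1) / 2 * N powr (p - 2)"
      using mult_left_mono[OF gap, of "p / 2"] p by (simp add: c_def N_def mult_ac)
  qed (use p N1 t \<gamma> in \<open>auto simp: c_def\<close>)
  finally have "(N + c * (W - N)) / N \<le> P / N"
    using N1 by (intro divide_right_mono) auto
  also have "(N + c * (W - N)) / N = 1 + p / 2 * ((1 - \<gamma>) * (W / N - 1))"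
    using N1 diff_divide_distrib[of W N N, symmetric] by (simp add: c_def add_divide_distrib)
  finally have PN: "1 + p / 2 * ((1 - \<gamma>) * (W / N - 1)) \<le> P / N" .
  have V': "0 \<le> (1 - \<gamma>) * (W / N - 1)"
    using V N1 \<gamma> by (intro mult_nonneg_nonneg) (auto simp: field_simps)
  have "1 + (1 - \<gamma>) * (W / N - 1) = ((1 + (1 - \<gamma>) * (W / N - 1)) powr (p / 2)) powr (2 / p)"
    using V' p by (simp add: powr_powr)
  also have "\<dots> \<le> (P / N) powr (2 / p)"
    using powr_le_linear[OF V', of "p / 2"] PN p by (intro powr_mono2) auto
  finally have "N * (1 + (1 - \<gamma>) * (W / N - 1)) \<le> N * (P / N) powr (2 / p)"
    using N1 by simp
  moreover have "N * (1 + (1 - \<gamma>) * (W / N - 1)) = (1 - \<gamma>) * W + \<gamma> * N"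
    using N1 by (simp add: field_simps)
  moreover have P: "P \<ge> 0"
    unfolding P_def by (intro sum_nonneg) auto
  moreover have "N * (P / N) powr (2 / p) = N powr (1 - 2 / p) * P powr (2 / p)"
    using N1 P by (simp add: powr_divide powr_diff)
  ultimately have *: "(1 - \<gamma>) * W + \<gamma> * N \<le> N powr (1 - 2 / p) * P powr (2 / p)"
    by simp
  have "(\<Sum>x\<in>X. (f x)\<^sup>2) = m\<^sup>2 * W"
    using m by (simp add: W_def t_def sum_distrib_left field_simps)
  moreover have "\<gamma> * S\<^sup>2 / N = \<gamma> * (m\<^sup>2 * N)"
    using N1 by (simp add: m_def power2_eq_square)
  moreover have "(\<Sum>x\<in>X. f x powr p) = m powr p * P"
    using m f by (simp add: P_def t_def sum_distrib_left powr_divide)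
  then have "(\<Sum>x\<in>X. f x powr p) powr (2 / p) = m\<^sup>2 * P powr (2 / p)"
    using m P p by (simp add: powr_mult powr_powr powr_numeral)
  ultimately show ?thesis
    using mult_left_mono[OF *, of "m\<^sup>2"]
    by (simp add: algebra_simps flip: N_def S_def)
qed

section \<open>The Efron-Stein inequality on the cube\<close>

abbreviation cube :: "nat \<Rightarrow> 'i set \<Rightarrow> ('i \<Rightarrow> nat) set" where
  "cube s U \<equiv> U \<rightarrow>\<^sub>E {..<s}"

lemma finite_cube [simp]: "finite U \<Longrightarrow> finite (cube s U)"
  by (simp add: finite_PiE)

lemma card_cube: "finite U \<Longrightarrow> card (cube s U) = s ^ card U"
  by (simp add: card_PiE)

lemma sum_cube_insert:
  fixes h :: "('i \<Rightarrow> nat) \<Rightarrow> real"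
  assumes "i \<notin> U"
  shows "(\<Sum>x\<in>cube s (insert i U). h x) = (\<Sum>z\<in>cube s U. \<Sum>a<s. h (z(i := a)))"
proof -
  have "(\<Sum>x\<in>cube s (insert i U). h x) = (\<Sum>(a, z)\<in>{..<s} \<times> cube s U. h (z(i := a)))"
    using assms inj_combinator[of i U "\<lambda>_. {..<s}"]
    by (simp add: PiE_insert_eq sum.reindex case_prod_unfold)
  also have "\<dots> = (\<Sum>z\<in>cube s U. \<Sum>a<s. h (z(i := a)))"
    by (simp add: sum.swap[of _ "cube s U"] flip: sum.cartesian_product)
  finally show ?thesis .
qed

lemma sum_square_diff:
  fixes u :: "'a \<Rightarrow> real"
  assumes "finite I"
  shows "(\<Sum>a\<in>I. \<Sum>b\<in>I. (u a - u b)\<^sup>2) = 2 * (real (card I) * (\<Sum>a\<in>I. (u a)\<^sup>2) - (\<Sum>a\<in>I. u a)\<^sup>2)"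
proof -
  have "(\<Sum>a\<in>I. \<Sum>b\<in>I. (u a - u b)\<^sup>2)
      = (\<Sum>a\<in>I. \<Sum>b\<in>I. (u a)\<^sup>2) + (\<Sum>a\<in>I. \<Sum>b\<in>I. (u b)\<^sup>2) - 2 * (\<Sum>a\<in>I. \<Sum>b\<in>I. u a * u b)"
    by (simp add: power2_diff sum.distrib sum_subtractf sum_distrib_left mult.assoc)
  also have "(\<Sum>a\<in>I. \<Sum>b\<in>I. u a * u b) = (\<Sum>a\<in>I. u a)\<^sup>2"
    by (simp add: power2_eq_square sum_product)
  finally show ?thesis
    by (simp add: sum_distrib_left)
qed

text \<open>For \<open>i \<in> U\<close> this is \<open>2 * s\<close> times the summed squared
  deviation of \<open>f\<close> from its average over coordinate \<open>i\<close>: an unnormalised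
  influence, written with pairwise differences so that no conditional expectation is needed.\<close>

definition energy :: "nat \<Rightarrow> 'i set \<Rightarrow> 'i \<Rightarrow> (('i \<Rightarrow> nat) \<Rightarrow> real) \<Rightarrow> real" where
  "energy s U i f = (\<Sum>x\<in>cube s U. \<Sum>a<s. (f x - f (x(i := a)))\<^sup>2)"

lemma energy_insert_same:
  assumes "i \<notin> U"
  shows "energy s (insert i U) i f = (\<Sum>z\<in>cube s U.
    2 * (real s * (\<Sum>a<s. (f (z(i := a)))\<^sup>2) - (\<Sum>a<s. f (z(i := a)))\<^sup>2))"
  using assms by (simp add: energy_def sum_cube_insert sum_square_diff)

text \<open>Summing out a coordinate cannot raise the influence of another one, apart from scaling:
  Cauchy-Schwarz over the \<open>s\<close> values of coordinate \<open>i\<close>, after exchanging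
  the two commuting updates.\<close>

lemma energy_insert_other:
  assumes "i \<notin> U" "j \<noteq> i"
  shows "energy s U j (\<lambda>z. \<Sum>b<s. f (z(i := b))) \<le> real s * energy s (insert i U) j f"
proof -
  have "energy s U j (\<lambda>z. \<Sum>b<s. f (z(i := b)))
      = (\<Sum>z\<in>cube s U. \<Sum>a<s. (\<Sum>b<s. f (z(i := b)) - f (z(j := a, i := b)))\<^sup>2)"
    by (simp add: energy_def sum_subtractf)
  also have "\<dots> \<le> (\<Sum>z\<in>cube s U. \<Sum>a<s. (\<Sum>b<s. (f (z(i := b)) - f (z(j := a, i := b)))\<^sup>2) * real s)"
    by (intro sum_mono order_trans[OF sum_squared_le_sum_of_squares]) auto
  also have "\<dots> = real s * energy s (insert i U) j f"
  proof -
    have "energy s (insert i U) j f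
        = (\<Sum>z\<in>cube s U. \<Sum>b<s. \<Sum>a<s. (f (z(i := b)) - f (z(j := a, i := b)))\<^sup>2)"
      using assms by (simp add: energy_def sum_cube_insert fun_upd_twist[OF assms(2)])
    also have "\<dots> = (\<Sum>z\<in>cube s U. \<Sum>a<s. \<Sum>b<s. (f (z(i := b)) - f (z(j := a, i := b)))\<^sup>2)"
      by (intro sum.cong refl sum.swap)
    finally show ?thesis
      by (simp add: mult.commute[of _ "real s"] flip: sum_distrib_left)
  qed
  finally show ?thesis .
qed

text \<open>Induction on the coordinates. The variance splits into the variance within the lines in
  direction \<open>i\<close>, which is the new energy term, and that of the line sums
  \<open>F\<close>, to which the induction hypothesis applies. As \<open>F\<close> is a sum and not
  an average, a factor \<open>s\<close> appears and cancels against the one in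
  \<open>energy_insert_other\<close>.\<close>

lemma efron_stein:
  fixes f :: "('i \<Rightarrow> nat) \<Rightarrow> real"
  assumes "finite U" "0 < s"
  shows "2 * real s * ((\<Sum>x\<in>cube s U. (f x)\<^sup>2) - (\<Sum>x\<in>cube s U. f x)\<^sup>2 / real s ^ card U)
    \<le> (\<Sum>i\<in>U. energy s U i f)"
  using assms(1)
proof (induction U arbitrary: f rule: finite_induct)
  case empty
  then show ?case by simp
next
  case (insert i U)
  define F where "F = (\<lambda>z. \<Sum>b<s. f (z(i := b)))"
  have "2 * real s * ((\<Sum>z\<in>cube s U. (F z)\<^sup>2) - (\<Sum>z\<in>cube s U. F z)\<^sup>2 / real s ^ card U)
      \<le> (\<Sum>j\<in>U. energy s U j F)"
    by (rule insert.IH)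
  also have "\<dots> \<le> (\<Sum>j\<in>U. real s * energy s (insert i U) j f)"
    unfolding F_def using insert.hyps by (intro sum_mono energy_insert_other) auto
  finally have "2 * ((\<Sum>z\<in>cube s U. (F z)\<^sup>2) - (\<Sum>z\<in>cube s U. F z)\<^sup>2 / real s ^ card U)
      \<le> (\<Sum>j\<in>U. energy s (insert i U) j f)"
    using assms(2) by (simp add: mult.assoc mult.left_commute[of 2] flip: sum_distrib_left)
  moreover have "energy s (insert i U) i f
      = 2 * (real s * (\<Sum>x\<in>cube s (insert i U). (f x)\<^sup>2) - (\<Sum>z\<in>cube s U. (F z)\<^sup>2))"
    using insert.hyps
    by (simp add: energy_insert_same sum_cube_insert F_def sum_subtractf flip: sum_distrib_left)
  moreover have "(\<Sum>x\<in>cube s (insert i U). f x)\<^sup>2 / real s ^ card (insert i U)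
      = (\<Sum>z\<in>cube s U. F z)\<^sup>2 / real s ^ card U / real s"
    using insert.hyps by (simp add: sum_cube_insert F_def)
  ultimately show ?case
    using insert.hyps assms(2) by (simp add: right_diff_distrib)
qed

text \<open>The kernel is the all-ones matrix minus the identity, with eigenvalue
  \<open>s - 1\<close> on constants and -1 on mean-zero vectors. The right side allows
  \<open>s - 1\<close> on the former but only half of it on the latter, which suffices because
  \<open>1 \<le> (s - 1) / 2\<close>.\<close>

lemma sum_off_diagonal_le:
  fixes u v :: "nat \<Rightarrow> real"
  assumes s: "3 \<le> s"
  shows "(\<Sum>a<s. \<Sum>b\<in>{..<s} - {a}. u a * v b)
    \<le> (real s - 1) / 4 * ((\<Sum>a<s. (u a)\<^sup>2) + (\<Sum>a<s. u a)\<^sup>2 / real s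
        + (\<Sum>a<s. (v a)\<^sup>2) + (\<Sum>a<s. v a)\<^sup>2 / real s)"
proof -
  define A B C F G where "A = (\<Sum>a<s. (u a)\<^sup>2)" and "B = (\<Sum>a<s. (v a)\<^sup>2)"
    and "C = (\<Sum>a<s. u a * v a)" and "F = (\<Sum>a<s. u a)" and "G = (\<Sum>a<s. v a)"
  have "(\<Sum>a<s. \<Sum>b\<in>{..<s} - {a}. u a * v b) = (\<Sum>a<s. u a * (G - v a))"
    by (simp add: sum_diff1 G_def flip: sum_distrib_left)
  also have "\<dots> = F * G - C"
    by (simp add: right_diff_distrib sum_subtractf F_def C_def sum_distrib_right)
  finally have L: "(\<Sum>a<s. \<Sum>b\<in>{..<s} - {a}. u a * v b) = F * G - C" .
  have A: "F\<^sup>2 \<le> A * s" and B: "G\<^sup>2 \<le> B * s"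
    using sum_squared_le_sum_of_squares[of u "{..<s}"] sum_squared_le_sum_of_squares[of v "{..<s}"]
    by (simp_all add: A_def B_def F_def G_def)
  \<comment> \<open>\<open>C\<close> enters with a negative sign, so it must be bounded from below;
    Cauchy-Schwarz for \<open>u + v\<close> does this.\<close>
  have C: "(F + G)\<^sup>2 \<le> (A + B + 2 * C) * s"
    using sum_squared_le_sum_of_squares[of "\<lambda>a. u a + v a" "{..<s}"]
    by (simp add: A_def B_def C_def F_def G_def power2_sum sum.distrib sum_distrib_left mult.assoc)
  \<comment> \<open>The nonnegative weight \<open>real s - 3\<close> measures the distance of the
    eigenvalue -1 from its allowance.\<close>
  have "(real s - 3) * (F\<^sup>2 + G\<^sup>2) \<le> (real s - 3) * (A * s + B * s)"
    using s A B by (intro mult_left_mono) auto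
  moreover have "(real s - 1) * (F - G)\<^sup>2 \<ge> 0"
    using s by simp
  ultimately have "4 * s * (F * G - C) \<le> (real s - 1) * (A * s + F\<^sup>2 + B * s + G\<^sup>2)"
    using C by (simp add: algebra_simps power2_eq_square)
  then have "F * G - C \<le> (real s - 1) / 4 * (A + F\<^sup>2 / s + B + G\<^sup>2 / s)"
    using s by (simp add: field_simps)
  then show ?thesis
    unfolding L by (simp add: A_def B_def F_def G_def)
qed

text \<open>The cube is cut into lines in direction \<open>i\<close> and the off-diagonal bound is
  applied on each. On a line, half of the second moment plus the normalised squared sum equals the
  second moment minus half the line's variance term, which is what \<open>energy / (4 * s)\<close>
  records.\<close>

lemma sum_single_change_le:
  assumes s: "3 \<le> s" and i: "i \<in> U"
  shows "(\<Sum>x\<in>cube s U. \<Sum>a\<in>{..<s} - {x i}. f x * g (x(i := a)))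
    \<le> (real s - 1) / 2 * ((\<Sum>x\<in>cube s U. (f x)\<^sup>2) - energy s U i f / (4 * real s)
        + ((\<Sum>x\<in>cube s U. (g x)\<^sup>2) - energy s U i g / (4 * real s)))"
proof -
  define V where "V = U - {i}"
  have V: "i \<notin> V" "U = insert i V"
    using i by (auto simp: V_def)
  have e: "(\<Sum>x\<in>cube s U. (h x)\<^sup>2) - energy s U i h / (4 * real s)
      = (\<Sum>z\<in>cube s V. ((\<Sum>a<s. (h (z(i := a)))\<^sup>2) + (\<Sum>a<s. h (z(i := a)))\<^sup>2 / real s) / 2)" for h
  proof -
    have "(\<Sum>x\<in>cube s U. (h x)\<^sup>2) - energy s U i h / (4 * real s)
      = (\<Sum>z\<in>cube s V. (\<Sum>a<s. (h (z(i := a)))\<^sup>2)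
          - 2 * (real s * (\<Sum>a<s. (h (z(i := a)))\<^sup>2) - (\<Sum>a<s. h (z(i := a)))\<^sup>2) / (4 * real s))"
      by (simp only: V(2) energy_insert_same[OF V(1)] sum_cube_insert[OF V(1)]
          sum_subtractf sum_divide_distrib)
    also have "\<dots> = (\<Sum>z\<in>cube s V. ((\<Sum>a<s. (h (z(i := a)))\<^sup>2) + (\<Sum>a<s. h (z(i := a)))\<^sup>2 / real s) / 2)"
      using s by (intro sum.cong refl) (simp add: field_simps)
    finally show ?thesis .
  qed
  have "(\<Sum>x\<in>cube s U. \<Sum>a\<in>{..<s} - {x i}. f x * g (x(i := a)))
      = (\<Sum>z\<in>cube s V. \<Sum>a<s. \<Sum>b\<in>{..<s} - {a}. f (z(i := a)) * g (z(i := b)))"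
    using V by (simp add: sum_cube_insert)
  also have "\<dots> \<le> (\<Sum>z\<in>cube s V. (real s - 1) / 4 *
      ((\<Sum>a<s. (f (z(i := a)))\<^sup>2) + (\<Sum>a<s. f (z(i := a)))\<^sup>2 / real s
        + (\<Sum>a<s. (g (z(i := a)))\<^sup>2) + (\<Sum>a<s. g (z(i := a)))\<^sup>2 / real s))"
    by (intro sum_mono sum_off_diagonal_le s)
  also have "\<dots> = (real s - 1) / 2 * ((\<Sum>x\<in>cube s U. (f x)\<^sup>2) - energy s U i f / (4 * real s)
        + ((\<Sum>x\<in>cube s U. (g x)\<^sup>2) - energy s U i g / (4 * real s)))"
    unfolding e sum.distrib[symmetric] sum_distrib_left
    by (intro sum.cong refl) (simp add: field_simps)
  finally show ?thesis .
qed

section \<open>Hypercontractive forms\<close>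

text \<open>
  Sums instead of averages: the norm of a constant depends on the size of the set, and the
  constants below carry the compensating factor (card X) powr (1 - 2 / p).
\<close>
definition lp_norm :: "real \<Rightarrow> 'a set \<Rightarrow> ('a \<Rightarrow> real) \<Rightarrow> real" where
  "lp_norm p X f = (\<Sum>x\<in>X. f x powr p) powr (1 / p)"

lemma lp_norm_nonneg: "0 \<le> lp_norm p X f"
  by (simp add: lp_norm_def)

lemma lp_norm_powr:
  assumes "0 < p"
  shows "lp_norm p X f powr p = (\<Sum>x\<in>X. f x powr p)"
  using assms by (simp add: lp_norm_def powr_powr sum_nonneg)

lemma lp_norm_power2:
  assumes "0 < p"
  shows "(lp_norm p X f)\<^sup>2 = (\<Sum>x\<in>X. f x powr p) powr (2 / p)"
  using assms by (simp add: lp_norm_def power2_eq_square flip: powr_add)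

lemma lp_norm_divide:
  assumes "0 < p" "0 < c"
  shows "lp_norm p X (\<lambda>x. f x / c) = lp_norm p X f / c"
  using assms
  by (simp add: lp_norm_def powr_divide powr_powr sum_nonneg flip: sum_divide_distrib)

lemma lp_norm_eq_0_iff:
  assumes "finite X" "0 < p"
  shows "lp_norm p X f = 0 \<longleftrightarrow> (\<forall>x\<in>X. f x = 0)"
  using assms by (simp add: lp_norm_def sum_nonneg_eq_0_iff)

definition form :: "'a set \<Rightarrow> ('a \<Rightarrow> 'a \<Rightarrow> real) \<Rightarrow> ('a \<Rightarrow> real) \<Rightarrow> ('a \<Rightarrow> real) \<Rightarrow> real" where
  "form X w f g = (\<Sum>x\<in>X. \<Sum>y\<in>X. w x y * f x * g y)"

text \<open>Equal exponents on both sides are what the applications to indicators require.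
  Restricting to nonnegative functions makes \<open>f x powr p\<close> the true p-th power without
  absolute values.\<close>

definition hypercontractive :: "real \<Rightarrow> real \<Rightarrow> 'a set \<Rightarrow> ('a \<Rightarrow> 'a \<Rightarrow> real) \<Rightarrow> bool" where
  "hypercontractive p c X w \<longleftrightarrow>
    (\<forall>f g. (\<forall>x\<in>X. 0 \<le> f x) \<longrightarrow> (\<forall>x\<in>X. 0 \<le> g x) \<longrightarrow>
      form X w f g \<le> c * (lp_norm p X f * lp_norm p X g))"

text \<open>Scaling \<open>f\<close> and \<open>g\<close> to norm 1 makes the arithmetic mean of the
  squared norms equal to 1, so it may replace the product. A function of norm 0 vanishes on
  \<open>X\<close> and makes the form zero.\<close>

lemma hypercontractiveI_mean:
  assumes X: "finite X" and p: "0 < p"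
    and bound: "\<And>f g. (\<forall>x\<in>X. 0 \<le> f x) \<Longrightarrow> (\<forall>x\<in>X. 0 \<le> g x) \<Longrightarrow>
      form X w f g \<le> c / 2 * ((lp_norm p X f)\<^sup>2 + (lp_norm p X g)\<^sup>2)"
  shows "hypercontractive p c X w"
  unfolding hypercontractive_def
proof (intro allI impI)
  fix f g :: "'a \<Rightarrow> real"
  assume f: "\<forall>x\<in>X. 0 \<le> f x" and g: "\<forall>x\<in>X. 0 \<le> g x"
  define a b where "a = lp_norm p X f" and "b = lp_norm p X g"
  show "form X w f g \<le> c * (lp_norm p X f * lp_norm p X g)"
  proof (cases "a = 0 \<or> b = 0")
    case True
    then have "form X w f g = 0"
      using X p by (auto simp: a_def b_def lp_norm_eq_0_iff form_def intro!: sum.neutral)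
    then show ?thesis using True by (auto simp: a_def b_def)
  next
    case False
    then have ab: "a > 0" "b > 0"
      using lp_norm_nonneg[of p X] by (auto simp: a_def b_def order_less_le)
    have "form X w (\<lambda>x. f x / a) (\<lambda>x. g x / b)
        \<le> c / 2 * ((lp_norm p X (\<lambda>x. f x / a))\<^sup>2 + (lp_norm p X (\<lambda>x. g x / b))\<^sup>2)"
      using f g ab by (intro bound) auto
    also have "\<dots> = c"
      using ab p by (simp add: lp_norm_divide flip: a_def b_def)
    also have "form X w (\<lambda>x. f x / a) (\<lambda>x. g x / b) = form X w f g / (a * b)"
      by (simp add: form_def sum_divide_distrib)
    finally show ?thesis
      using ab by (simp add: a_def b_def field_simps)
  qed
qed

text \<open>With both outer points fixed, the bound on \<open>Y\<close> applies to the sections;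
  nonnegativity of \<open>w\<close> lets it be summed. What remains is the form on \<open>X\<close>
  at the section norms \<open>F\<close> and \<open>G\<close>.\<close>

lemma hypercontractive_Times:
  assumes p: "0 < p" and d: "0 \<le> d"
    and w: "\<And>x x'. 0 \<le> w x x'"
    and hw: "hypercontractive p c X w" and hv: "hypercontractive p d Y v"
  shows "hypercontractive p (c * d) (X \<times> Y) (\<lambda>(x, y) (x', y'). w x x' * v y y')"
  unfolding hypercontractive_def
proof (intro allI impI)
  fix f g :: "'a \<times> 'b \<Rightarrow> real"
  assume f: "\<forall>z\<in>X \<times> Y. 0 \<le> f z" and g: "\<forall>z\<in>X \<times> Y. 0 \<le> g z"
  define F G where "F = (\<lambda>x. lp_norm p Y (\<lambda>y. f (x, y)))" and "G = (\<lambda>x. lp_norm p Y (\<lambda>y. g (x, y)))"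
  have double: "(\<Sum>z\<in>X \<times> Y. h z) = (\<Sum>x\<in>X. \<Sum>y\<in>Y. h (x, y))" for h :: "'a \<times> 'b \<Rightarrow> real"
    by (simp add: sum.cartesian_product)
  have "form (X \<times> Y) (\<lambda>(x, y) (x', y'). w x x' * v y y') f g
      = (\<Sum>x\<in>X. \<Sum>y\<in>Y. \<Sum>x'\<in>X. \<Sum>y'\<in>Y. w x x' * v y y' * f (x, y) * g (x', y'))"
    by (simp add: form_def double)
  also have "\<dots> = (\<Sum>x\<in>X. \<Sum>x'\<in>X. \<Sum>y\<in>Y. \<Sum>y'\<in>Y. w x x' * v y y' * f (x, y) * g (x', y'))"
    by (intro sum.cong refl sum.swap)
  also have "\<dots> = (\<Sum>x\<in>X. \<Sum>x'\<in>X. w x x' * form Y v (\<lambda>y. f (x, y)) (\<lambda>y. g (x', y)))"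
    by (simp add: form_def sum_distrib_left mult.assoc)
  also have "\<dots> \<le> (\<Sum>x\<in>X. \<Sum>x'\<in>X. w x x' * (d * (F x * G x')))"
    using f g hv w by (intro sum_mono mult_left_mono) (auto simp: hypercontractive_def F_def G_def)
  also have "\<dots> = d * form X w F G"
    by (simp add: form_def sum_distrib_left mult_ac)
  also have "\<dots> \<le> d * (c * (lp_norm p X F * lp_norm p X G))"
    using hw d by (intro mult_left_mono) (auto simp: hypercontractive_def F_def G_def lp_norm_nonneg)
  \<comment> \<open>Inner and outer exponent agree, so taking the p-th power undoes the inner root
    and the iterated norm is the joint norm.\<close>
  also have "lp_norm p X F = lp_norm p (X \<times> Y) f"
    using p unfolding lp_norm_def[of p X] F_def lp_norm_powr[OF p]
    by (simp add: lp_norm_def sum.cartesian_product)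
  also have "lp_norm p X G = lp_norm p (X \<times> Y) g"
    using p unfolding lp_norm_def[of p X] G_def lp_norm_powr[OF p]
    by (simp add: lp_norm_def sum.cartesian_product)
  finally show "form (X \<times> Y) (\<lambda>(x, y) (x', y'). w x x' * v y y') f g
      \<le> c * d * (lp_norm p (X \<times> Y) f * lp_norm p (X \<times> Y) g)"
    by (simp add: mult_ac)
qed

lemma hypercontractive_reindex:
  fixes w :: "'b \<Rightarrow> 'b \<Rightarrow> real"
  assumes \<phi>: "bij_betw \<phi> X Z" and h: "hypercontractive p c X (\<lambda>x y. w (\<phi> x) (\<phi> y))"
  shows "hypercontractive p c Z w"
  unfolding hypercontractive_def
proof (intro allI impI)
  fix f g :: "'b \<Rightarrow> real"
  assume f: "\<forall>z\<in>Z. 0 \<le> f z" and g: "\<forall>z\<in>Z. 0 \<le> g z"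
  have "form X (\<lambda>x y. w (\<phi> x) (\<phi> y)) (f \<circ> \<phi>) (g \<circ> \<phi>) \<le> c * (lp_norm p X (f \<circ> \<phi>) * lp_norm p X (g \<circ> \<phi>))"
    using h f g bij_betwE[OF \<phi>] by (auto simp: hypercontractive_def)
  moreover have "form X (\<lambda>x y. w (\<phi> x) (\<phi> y)) (f \<circ> \<phi>) (g \<circ> \<phi>) = form Z w f g"
    by (simp add: form_def flip: sum.reindex_bij_betw[OF \<phi>])
  moreover have "lp_norm p X (h \<circ> \<phi>) = lp_norm p Z h" for h :: "'b \<Rightarrow> real"
    by (simp add: lp_norm_def flip: sum.reindex_bij_betw[OF \<phi>])
  ultimately show "form Z w f g \<le> c * (lp_norm p Z f * lp_norm p Z g)"
    by simp
qed

section \<open>Changing exactly one coordinate of a block\<close>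

definition diff_set :: "'i set \<Rightarrow> ('i \<Rightarrow> 'b) \<Rightarrow> ('i \<Rightarrow> 'b) \<Rightarrow> 'i set" where
  "diff_set U x y = {i \<in> U. x i \<noteq> y i}"

lemma diff_set_eq_singleton_iff:
  assumes "x \<in> cube s U" "y \<in> cube s U" "i \<in> U"
  shows "diff_set U x y = {i} \<longleftrightarrow> (\<exists>a\<in>{..<s} - {x i}. y = x(i := a))"
proof
  assume d: "diff_set U x y = {i}"
  have "y j = (x(i := y i)) j" for j
    using d assms by (cases "j \<in> U") (auto simp: diff_set_def set_eq_iff PiE_def extensional_def)
  then have "y = x(i := y i)" by blast
  moreover have "y i \<in> {..<s} - {x i}"
    using d assms by (auto simp: diff_set_def set_eq_iff)
  ultimately show "\<exists>a\<in>{..<s} - {x i}. y = x(i := a)" by blast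
qed (use assms in \<open>auto simp: diff_set_def split: if_splits\<close>)

text \<open>A set equals at most one singleton, so the indicator splits into a sum over
  \<open>i\<close>; for fixed \<open>x\<close> and \<open>i\<close> the admissible \<open>y\<close>
  are parametrised by the new value at \<open>i\<close>.\<close>

lemma form_single_change:
  fixes f g :: "('i \<Rightarrow> nat) \<Rightarrow> real"
  assumes "finite U"
  shows "form (cube s U) (\<lambda>x y. of_bool (diff_set U x y \<in> (\<lambda>i. {i}) ` U)) f g
    = (\<Sum>i\<in>U. \<Sum>x\<in>cube s U. \<Sum>a\<in>{..<s} - {x i}. f x * g (x(i := a)))"
proof -
  have split: "of_bool (T \<in> (\<lambda>i. {i}) ` U) = (\<Sum>i\<in>U. of_bool (T = {i}) :: real)" for T
  proof (cases "T \<in> (\<lambda>i. {i}) ` U")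
    case True
    then obtain j where "j \<in> U" "T = {j}" by auto
    then show ?thesis using assms by (simp add: of_bool_def)
  next
    case False
    then have "(\<Sum>i\<in>U. of_bool (T = {i}) :: real) = 0"
      by (intro sum.neutral) auto
    then show ?thesis using False by simp
  qed
  have row: "(\<Sum>y\<in>cube s U. of_bool (diff_set U x y = {i}) * f x * g y)
      = (\<Sum>a\<in>{..<s} - {x i}. f x * g (x(i := a)))" if "x \<in> cube s U" "i \<in> U" for x i
  proof -
    have "(\<Sum>y\<in>cube s U. of_bool (diff_set U x y = {i}) * f x * g y)
        = (\<Sum>y\<in>{y \<in> cube s U. diff_set U x y = {i}}. f x * g y)"
      using assms by (intro sum.mono_neutral_cong_right) auto
    also have "{y \<in> cube s U. diff_set U x y = {i}} = (\<lambda>a. x(i := a)) ` ({..<s} - {x i})"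
    proof -
      have "x(i := a) \<in> cube s U" if "a < s" for a
        using that \<open>x \<in> cube s U\<close> \<open>i \<in> U\<close> by (auto simp: PiE_def extensional_def)
      moreover have "diff_set U x (x(i := a)) = {i}" if "a \<noteq> x i" for a
        using that \<open>i \<in> U\<close> by (auto simp: diff_set_def)
      moreover have "y \<in> (\<lambda>a. x(i := a)) ` ({..<s} - {x i})"
        if "y \<in> cube s U" "diff_set U x y = {i}" for y
        using that diff_set_eq_singleton_iff \<open>x \<in> cube s U\<close> \<open>i \<in> U\<close> by (metis image_eqI)
      ultimately show ?thesis
        by auto
    qed
    also have "(\<Sum>y\<in>\<dots>. f x * g y) = (\<Sum>a\<in>{..<s} - {x i}. f x * g (x(i := a)))"
      by (subst sum.reindex) (auto intro!: inj_onI dest: fun_upd_eqD)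
    finally show ?thesis .
  qed
  have "form (cube s U) (\<lambda>x y. of_bool (diff_set U x y \<in> (\<lambda>i. {i}) ` U)) f g
      = (\<Sum>x\<in>cube s U. \<Sum>y\<in>cube s U. \<Sum>i\<in>U. of_bool (diff_set U x y = {i}) * f x * g y)"
    unfolding form_def split by (simp add: sum_distrib_right)
  also have "\<dots> = (\<Sum>x\<in>cube s U. \<Sum>i\<in>U. \<Sum>y\<in>cube s U. of_bool (diff_set U x y = {i}) * f x * g y)"
    by (intro sum.cong refl sum.swap)
  also have "\<dots> = (\<Sum>x\<in>cube s U. \<Sum>i\<in>U. \<Sum>a\<in>{..<s} - {x i}. f x * g (x(i := a)))"
    by (intro sum.cong refl row)
  also have "\<dots> = (\<Sum>i\<in>U. \<Sum>x\<in>cube s U. \<Sum>a\<in>{..<s} - {x i}. f x * g (x(i := a)))"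
    by (rule sum.swap)
  finally show ?thesis .
qed

text \<open>The single-change bounds are added over all coordinates of the block; the constant
  contains the number \<open>card U * (s - 1)\<close> of single changes of a point.\<close>

lemma hypercontractive_single_change:
  fixes U :: "'i set"
  assumes s: "3 \<le> s" and U: "finite U" "U \<noteq> {}" and p: "1 < p" "p \<le> 2"
    and gap: "1 - 1 / (2 * real (card U)) \<le> (p - 1) * (real s ^ card U) powr (p - 2)"
  shows "hypercontractive p (real (card U) * (real s - 1) * (real s ^ card U) powr (1 - 2 / p))
    (cube s U) (\<lambda>x y. of_bool (diff_set U x y \<in> (\<lambda>i. {i}) ` U))"
proof (rule hypercontractiveI_mean)
  define m N where "m = real (card U)" and "N = real s ^ card U"
  have m: "m \<ge> 1"
    using U by (simp add: m_def Suc_leI card_gt_0_iff)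
  have N: "N = real (card (cube s U))"
    using U by (simp add: N_def card_cube)
  have ne: "cube s U \<noteq> {}"
    using s U card_cube[of U s] by auto
  have Q: "m * (\<Sum>x\<in>cube s U. (h x)\<^sup>2) - (\<Sum>i\<in>U. energy s U i h / (4 * real s))
      \<le> m * N powr (1 - 2 / p) * (lp_norm p (cube s U) h)\<^sup>2"
    if h: "\<forall>x\<in>cube s U. 0 \<le> h x" for h
  proof -
    define A S where "A = (\<Sum>x\<in>cube s U. (h x)\<^sup>2)" and "S = (\<Sum>x\<in>cube s U. h x)"
    have "(A - S\<^sup>2 / N) / 2 \<le> (\<Sum>i\<in>U. energy s U i h) / (4 * real s)"
      using efron_stein[OF U(1), of s h] s by (simp add: A_def S_def N_def field_simps)
    \<comment> \<open>Efron-Stein replaces the total energy by half the variance. Spread over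
      \<open>m\<close> coordinates this is \<open>\<gamma> = 1 / (2 * m)\<close> in
      \<open>quadratic_form_le_lp\<close>.\<close>
    then have "m * A - (\<Sum>i\<in>U. energy s U i h / (4 * real s))
        \<le> m * ((1 - 1 / (2 * m)) * A + 1 / (2 * m) * S\<^sup>2 / N)"
      using m by (simp add: algebra_simps diff_divide_distrib flip: sum_divide_distrib)
    also have "\<dots> \<le> m * (N powr (1 - 2 / p) * (lp_norm p (cube s U) h)\<^sup>2)"
      using quadratic_form_le_lp[of "cube s U" h p "1 / (2 * m)"] U ne h p m gap
      by (intro mult_left_mono)
        (simp_all add: lp_norm_power2 A_def S_def N m_def card_cube)
    finally show ?thesis by (simp add: A_def mult.assoc)
  qed
  show "form (cube s U) (\<lambda>x y. of_bool (diff_set U x y \<in> (\<lambda>i. {i}) ` U)) f g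
      \<le> real (card U) * (real s - 1) * (real s ^ card U) powr (1 - 2 / p) / 2 *
        ((lp_norm p (cube s U) f)\<^sup>2 + (lp_norm p (cube s U) g)\<^sup>2)"
    if f: "\<forall>x\<in>cube s U. 0 \<le> f x" and g: "\<forall>x\<in>cube s U. 0 \<le> g x" for f g
  proof -
    have "form (cube s U) (\<lambda>x y. of_bool (diff_set U x y \<in> (\<lambda>i. {i}) ` U)) f g
        \<le> (\<Sum>i\<in>U. (real s - 1) / 2 * ((\<Sum>x\<in>cube s U. (f x)\<^sup>2) - energy s U i f / (4 * real s)
          + ((\<Sum>x\<in>cube s U. (g x)\<^sup>2) - energy s U i g / (4 * real s))))"
      unfolding form_single_change[OF U(1)] by (intro sum_mono sum_single_change_le s)
    also have "\<dots> = (real s - 1) / 2 *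
        ((m * (\<Sum>x\<in>cube s U. (f x)\<^sup>2) - (\<Sum>i\<in>U. energy s U i f / (4 * real s)))
          + (m * (\<Sum>x\<in>cube s U. (g x)\<^sup>2) - (\<Sum>i\<in>U. energy s U i g / (4 * real s))))"
      by (simp only: sum_distrib_left[symmetric] sum.distrib sum_subtractf sum_constant m_def)
    also have "\<dots> \<le> (real s - 1) / 2 * (m * N powr (1 - 2 / p) * (lp_norm p (cube s U) f)\<^sup>2
        + m * N powr (1 - 2 / p) * (lp_norm p (cube s U) g)\<^sup>2)"
      using Q[OF f] Q[OF g] s by (intro mult_left_mono add_mono) auto
    also have "\<dots> = m * (real s - 1) * N powr (1 - 2 / p) / 2 *
        ((lp_norm p (cube s U) f)\<^sup>2 + (lp_norm p (cube s U) g)\<^sup>2)"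
      by (simp add: distrib_left mult_ac)
    finally show ?thesis
      by (simp add: m_def N_def)
  qed
qed (use U p in auto)

section \<open>Products of blocks\<close>

lemma bij_betw_merge_cube:
  assumes "B \<inter> R = {}"
  shows "bij_betw (merge B R) (cube s B \<times> cube s R) (cube s (B \<union> R))"
proof (rule bij_betwI[where g = "\<lambda>z. (restrict z B, restrict z R)"])
  show "merge B R \<in> cube s B \<times> cube s R \<rightarrow> cube s (B \<union> R)"
    using assms by (auto simp: PiE_cancel_merge)
  show "(\<lambda>z. (restrict z B, restrict z R)) \<in> cube s (B \<union> R) \<rightarrow> cube s B \<times> cube s R"
    by auto
  show "(restrict (merge B R z) B, restrict (merge B R z) R) = z" if "z \<in> cube s B \<times> cube s R" for z
    using that assms by (cases z) (simp add: PiE_restrict[of _ _ "\<lambda>_. {..<s}"])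
  show "merge B R (restrict z B, restrict z R) = z" if "z \<in> cube s (B \<union> R)" for z
    using that by (auto simp: merge_def fun_eq_iff PiE_def extensional_def)
qed

lemma diff_set_subset: "diff_set U x y \<subseteq> U"
  by (auto simp: diff_set_def)

lemma diff_set_merge:
  assumes "B \<inter> R = {}"
  shows "diff_set (B \<union> R) (merge B R (x, y)) (merge B R (x', y')) = diff_set B x x' \<union> diff_set R y y'"
  using assms by (auto simp: diff_set_def merge_def)

lemma inj_on_disjoint_Un:
  assumes "B \<inter> R = {}"
  shows "inj_on (\<lambda>(S, T). S \<union> T) (Pow B \<times> Pow R)"
  using assms by (intro inj_onI) (auto; blast)

text \<open>Disjointness of the blocks means that a union determines its two pieces, so membership
  factors and the kernel becomes a product kernel after identifying the cube with a product of
  cubes.\<close>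

lemma hypercontractive_cube_Un:
  assumes disj: "B \<inter> R = {}" and sub: "\<S> \<subseteq> Pow B" "\<T> \<subseteq> Pow R" and p: "0 < p" and d: "0 \<le> d"
    and hB: "hypercontractive p c (cube s B) (\<lambda>x y. of_bool (diff_set B x y \<in> \<S>))"
    and hR: "hypercontractive p d (cube s R) (\<lambda>x y. of_bool (diff_set R x y \<in> \<T>))"
  shows "hypercontractive p (c * d) (cube s (B \<union> R))
    (\<lambda>x y. of_bool (diff_set (B \<union> R) x y \<in> (\<lambda>(S, T). S \<union> T) ` (\<S> \<times> \<T>)))"
proof (rule hypercontractive_reindex[OF bij_betw_merge_cube[OF disj]])
  have iff: "S \<union> T \<in> (\<lambda>(S, T). S \<union> T) ` (\<S> \<times> \<T>) \<longleftrightarrow> S \<in> \<S> \<and> T \<in> \<T>"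
    if "S \<subseteq> B" "T \<subseteq> R" for S T
    using inj_on_image_mem_iff[OF inj_on_disjoint_Un[OF disj], of "(S, T)" "\<S> \<times> \<T>"]
      Sigma_mono[OF sub(1), of "\<lambda>_. \<T>" "\<lambda>_. Pow R"] sub that
    by auto
  have eq: "(\<lambda>z z'. of_bool (diff_set (B \<union> R) (merge B R z) (merge B R z') \<in> (\<lambda>(S, T). S \<union> T) ` (\<S> \<times> \<T>)))
    = (\<lambda>(x, y) (x', y'). of_bool (diff_set B x x' \<in> \<S>) * (of_bool (diff_set R y y' \<in> \<T>) :: real))"
    by (intro ext) (clarsimp simp: diff_set_merge[OF disj] iff diff_set_subset of_bool_conj)
  show "hypercontractive p (c * d) (cube s B \<times> cube s R)
    (\<lambda>z z'. of_bool (diff_set (B \<union> R) (merge B R z) (merge B R z') \<in> (\<lambda>(S, T). S \<union> T) ` (\<S> \<times> \<T>)))"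
    unfolding eq by (rule hypercontractive_Times[OF p d _ hB hR]) simp
qed

lemma hypercontractive_cube_empty:
  assumes "0 < p"
  shows "hypercontractive p 1 (cube s {}) (\<lambda>x y. of_bool (diff_set {} x y \<in> {{}}))"
  using assms by (simp add: hypercontractive_def form_def lp_norm_def diff_set_def powr_powr)

text \<open>The family consists of the transversals of a partition into \<open>k\<close> blocks of
  size at most \<open>b\<close>, built by induction on \<open>k\<close>. Only its cardinality, the
  size of its members and the form bound are kept, since the later averaging over permutations uses
  nothing else.\<close>

lemma transversal_family:
  fixes U :: "'i set"
  assumes s: "3 \<le> s" and p: "1 < p" "p \<le> 2"
    and gap: "\<And>m. 1 \<le> m \<Longrightarrow> m \<le> b \<Longrightarrow>
      1 - 1 / (2 * real m) \<le> (p - 1) * (real s ^ m) powr (p - 2)"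
    and "finite U" "k \<le> card U" "card U \<le> b * k"
  shows "\<exists>\<T>. \<T> \<noteq> {} \<and> \<T> \<subseteq> {T. T \<subseteq> U \<and> card T = k} \<and>
    hypercontractive p (real (card \<T>) * (real s - 1) ^ k * (real s ^ card U) powr (1 - 2 / p))
      (cube s U) (\<lambda>x y. of_bool (diff_set U x y \<in> \<T>))"
  using assms(5-7)
proof (induction k arbitrary: U)
  case 0
  then have "U = {}" by simp
  then show ?case
    using p by (intro exI[of _ "{{}}"]) (simp add: hypercontractive_cube_empty[simplified])
next
  case (Suc k)
  \<comment> \<open>The new block is as large as \<open>b\<close> allows while leaving at least
    \<open>k\<close> coordinates, one for each remaining block.\<close>
  define m where "m = min b (card U - k)"
  have b: "1 \<le> b"
    using Suc.prems by (cases b) auto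
  have m: "1 \<le> m" "m \<le> b" "m \<le> card U"
    using b Suc.prems by (auto simp: m_def)
  obtain B where B: "B \<subseteq> U" "card B = m" "finite B"
    using obtain_subset_with_card_n[OF m(3)] .
  define R where "R = U - B"
  have R: "U = B \<union> R" "B \<inter> R = {}" "finite R"
    using B Suc.prems by (auto simp: R_def)
  have cR: "card U = m + card R"
    using R B by (simp add: card_Un_disjoint)
  have "k \<le> b * k"
    using b by simp
  moreover have "card R = k \<or> card R = card U - b \<and> b + k \<le> card U"
    using cR Suc.prems by (auto simp: m_def min_def split: if_splits)
  moreover have "card U \<le> b + b * k"
    using Suc.prems by simp
  ultimately have "k \<le> card R" "card R \<le> b * k"
    by linarith+
  then obtain \<T> where \<T>: "\<T> \<noteq> {}" "\<T> \<subseteq> {T. T \<subseteq> R \<and> card T = k}"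
    and h: "hypercontractive p (real (card \<T>) * (real s - 1) ^ k * (real s ^ card R) powr (1 - 2 / p))
      (cube s R) (\<lambda>x y. of_bool (diff_set R x y \<in> \<T>))"
    using Suc.IH[OF R(3)] by blast
  define \<S> where "\<S> = (\<lambda>i. {i}) ` B"
  define \<W> where "\<W> = (\<lambda>(S, T). S \<union> T) ` (\<S> \<times> \<T>)"
  have sub: "\<S> \<subseteq> Pow B" "\<T> \<subseteq> Pow R"
    using \<T> by (auto simp: \<S>_def)
  have "card \<W> = card (\<S> \<times> \<T>)"
    unfolding \<W>_def using sub
    by (intro card_image inj_on_subset[OF inj_on_disjoint_Un[OF R(2)]]) auto
  also have "\<dots> = m * card \<T>"
    by (simp add: \<S>_def card_cartesian_product card_image B)
  finally have c\<W>: "card \<W> = m * card \<T>" .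
  have "B \<noteq> {}"
    using B m by auto
  then have "\<W> \<noteq> {}"
    using \<T> by (simp add: \<W>_def \<S>_def)
  moreover have "\<W> \<subseteq> {T. T \<subseteq> U \<and> card T = Suc k}"
  proof
    fix W assume "W \<in> \<W>"
    then obtain i T where W: "W = insert i T" "i \<in> B" "T \<in> \<T>"
      by (auto simp: \<W>_def \<S>_def)
    then have "T \<subseteq> R" "card T = k"
      using \<T> by auto
    moreover from \<open>T \<subseteq> R\<close> have "i \<notin> T"
      using W R by auto
    moreover from \<open>T \<subseteq> R\<close> have "finite T"
      using R finite_subset by blast
    ultimately show "W \<in> {T. T \<subseteq> U \<and> card T = Suc k}"
      using W R by auto
  qed
  moreover have "hypercontractive p (real (card \<W>) * (real s - 1) ^ Suc k * (real s ^ card U) powr (1 - 2 / p))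
      (cube s U) (\<lambda>x y. of_bool (diff_set U x y \<in> \<W>))"
  proof -
    have "hypercontractive p (real m * (real s - 1) * (real s ^ m) powr (1 - 2 / p))
        (cube s B) (\<lambda>x y. of_bool (diff_set B x y \<in> \<S>))"
      using hypercontractive_single_change[OF s B(3) \<open>B \<noteq> {}\<close> p] gap[OF m(1,2)] B
      by (simp add: \<S>_def)
    from hypercontractive_cube_Un[OF R(2) sub _ _ this h]
    have "hypercontractive p (real m * (real s - 1) * (real s ^ m) powr (1 - 2 / p)
        * (real (card \<T>) * (real s - 1) ^ k * (real s ^ card R) powr (1 - 2 / p)))
        (cube s U) (\<lambda>x y. of_bool (diff_set U x y \<in> \<W>))"
      using s p by (simp add: \<W>_def flip: R(1))
    moreover have "real m * (real s - 1) * (real s ^ m) powr (1 - 2 / p)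
        * (real (card \<T>) * (real s - 1) ^ k * (real s ^ card R) powr (1 - 2 / p))
      = real (card \<W>) * (real s - 1) ^ Suc k * (real s ^ card U) powr (1 - 2 / p)"
      by (simp add: c\<W> cR power_add powr_mult)
    ultimately show ?thesis by simp
  qed
  ultimately show ?case by blast
qed

section \<open>Random subsets as images of transversals\<close>

text \<open>
  Summing h (\<pi> ` T) over all permutations \<pi> gives a value independent of T; summing it over all
  k-subsets T as well identifies this value without counting stabilisers.
\<close>
lemma sum_k_subsets_le:
  fixes h :: "'i set \<Rightarrow> real"
  assumes U: "finite U" and \<T>: "\<T> \<noteq> {}" "\<T> \<subseteq> {T. T \<subseteq> U \<and> card T = k}"
    and bound: "\<And>\<pi>. \<pi> permutes U \<Longrightarrow> (\<Sum>T\<in>\<T>. h (\<pi> ` T)) \<le> real (card \<T>) * M"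
  shows "(\<Sum>J | J \<subseteq> U \<and> card J = k. h J) \<le> real (card U choose k) * M"
proof -
  define \<J> where "\<J> = {J. J \<subseteq> U \<and> card J = k}"
  define perms where "perms = {\<pi>. \<pi> permutes U}"
  define c where "c = (\<lambda>T. \<Sum>\<pi>\<in>perms. h (\<pi> ` T))"
  have "finite \<J>" "\<T> \<subseteq> \<J>"
    using U \<T> by (auto simp: \<J>_def)
  then have fin: "finite \<J>" "finite perms" "finite \<T>"
    using finite_permutations[OF U] finite_subset by (auto simp: perms_def)
  have c_eq: "c T = c T'" if TT: "T \<in> \<J>" "T' \<in> \<J>" for T T'
  proof -
    obtain f where f: "bij_betw f T' T"
      using TT U by (metis (mono_tags, lifting) \<J>_def finite_same_card_bij finite_subset mem_Collect_eq)
    have "finite T" "finite T'"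
      using TT U finite_subset by (auto simp: \<J>_def)
    then have "card (U - T') = card (U - T)"
      using TT by (simp add: \<J>_def card_Diff_subset)
    then obtain g where g: "bij_betw g (U - T') (U - T)"
      using U by (metis finite_Diff finite_same_card_bij)
    \<comment> \<open>A bijection from \<open>T'\<close> to \<open>T\<close> and one between their
      complements are glued to a permutation of \<open>U\<close>; composing with it on the right
      identifies the two sums over permutations.\<close>
    define \<sigma> where "\<sigma> = (\<lambda>i. if i \<in> T' then f i else if i \<in> U then g i else i)"
    have "bij_betw \<sigma> (T' \<union> (U - T')) (T \<union> (U - T))"
    proof (rule bij_betw_combine)
      show "bij_betw \<sigma> T' T"
        using f by (subst bij_betw_cong[of _ _ f]) (auto simp: \<sigma>_def)
      show "bij_betw \<sigma> (U - T') (U - T)"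
        using g by (subst bij_betw_cong[of _ _ g]) (auto simp: \<sigma>_def)
    qed auto
    then have "bij_betw \<sigma> U U"
      using TT by (simp add: \<J>_def Un_absorb1)
    then have \<sigma>: "\<sigma> permutes U"
      using TT by (intro bij_imp_permutes) (auto simp: \<sigma>_def \<J>_def)
    have img: "\<sigma> ` T' = T"
      using f by (auto simp: \<sigma>_def bij_betw_def)
    have "c T = (\<Sum>\<pi>\<in>perms. h ((\<pi> \<circ> \<sigma>) ` T'))"
      by (simp only: c_def image_comp[symmetric] img)
    also have "\<dots> = c T'"
      unfolding c_def perms_def
      using sum_permutations_compose_right[OF \<sigma>, of "\<lambda>\<pi>. h (\<pi> ` T')"] by simp
    finally show ?thesis .
  qed
  obtain T0 where T0: "T0 \<in> \<T>" "T0 \<in> \<J>"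
    using \<T> by (auto simp: \<J>_def)
  have "real (card \<T>) * c T0 = (\<Sum>T\<in>\<T>. c T)"
    using c_eq[OF _ T0(2)] \<T> by (simp add: \<J>_def subset_iff)
  also have "\<dots> = (\<Sum>\<pi>\<in>perms. \<Sum>T\<in>\<T>. h (\<pi> ` T))"
    unfolding c_def by (rule sum.swap)
  also have "\<dots> \<le> (\<Sum>\<pi>\<in>perms. real (card \<T>) * M)"
    by (intro sum_mono bound) (simp add: perms_def)
  also have "\<dots> = real (card \<T>) * (real (card perms) * M)"
    by simp
  finally have c_le: "c T0 \<le> real (card perms) * M"
    using \<T> fin by (simp add: card_gt_0_iff)
  \<comment> \<open>Each permutation acts bijectively on the k-subsets, so the inner sum on the
    right does not depend on \<open>\<pi>\<close>.\<close>
  have "real (card perms) * (\<Sum>J\<in>\<J>. h J) = (\<Sum>\<pi>\<in>perms. \<Sum>J\<in>\<J>. h (\<pi> ` J))"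
  proof -
    have "(\<Sum>J\<in>\<J>. h (\<pi> ` J)) = (\<Sum>J\<in>\<J>. h J)" if "\<pi> \<in> perms" for \<pi>
    proof -
      have \<pi>: "\<pi> permutes U" "inj \<pi>"
        using that by (auto simp: perms_def permutes_inj)
      have inv: "inv \<pi> permutes U"
        using \<pi>(1) by (rule permutes_inv)
      show ?thesis
      proof (rule sum.reindex_bij_witness[where i = "image (inv \<pi>)" and j = "image \<pi>"])
        show "inv \<pi> ` \<pi> ` J = J" for J
          using \<pi> by (simp add: image_comp)
        show "\<pi> ` inv \<pi> ` J = J" for J
          using \<pi> by (simp add: image_comp permutes_inv_o)
        show "\<pi> ` J \<in> \<J>" if "J \<in> \<J>" for J
          using that \<pi> permutes_image[OF \<pi>(1)] by (auto simp: \<J>_def card_image inj_on_subset[OF \<pi>(2)])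
        show "inv \<pi> ` J \<in> \<J>" if "J \<in> \<J>" for J
          using that permutes_image[OF inv] permutes_inj[OF inv]
          by (auto simp: \<J>_def card_image inj_on_subset)
      qed auto
    qed
    then show ?thesis by simp
  qed
  also have "\<dots> = (\<Sum>J\<in>\<J>. c J)"
    unfolding c_def by (rule sum.swap)
  also have "\<dots> = real (card \<J>) * c T0"
    using c_eq[OF _ T0(2)] by simp
  also have "\<dots> \<le> real (card \<J>) * (real (card perms) * M)"
    using c_le by (intro mult_left_mono) auto
  finally have "real (card perms) * (\<Sum>J\<in>\<J>. h J) \<le> real (card perms) * (real (card \<J>) * M)"
    by (simp add: mult_ac)
  moreover have "id \<in> perms"
    by (simp add: perms_def permutes_id)
  then have "card perms > 0"
    using fin by (auto simp: card_gt_0_iff)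
  moreover have "card \<J> = card U choose k"
    unfolding \<J>_def by (rule n_subsets[OF U])
  ultimately show ?thesis
    by (simp add: \<J>_def)
qed

section \<open>Spherical noise\<close>

text \<open>Moving the permutation from the subset to the points lets one fixed family of
  transversals serve for all its relabellings.\<close>

lemma diff_set_comp_permutes:
  assumes \<pi>: "\<pi> permutes U"
  shows "diff_set U x y = \<pi> ` T \<longleftrightarrow> diff_set U (x \<circ> \<pi>) (y \<circ> \<pi>) = T"
proof -
  have "\<pi> ` diff_set U (x \<circ> \<pi>) (y \<circ> \<pi>) = diff_set U x y"
  proof (intro set_eqI iffI)
    fix j assume "j \<in> diff_set U x y"
    then show "j \<in> \<pi> ` diff_set U (x \<circ> \<pi>) (y \<circ> \<pi>)"
      using \<pi> permutes_in_image[OF permutes_inv[OF \<pi>], of j] permutes_inverses(1)[OF \<pi>, of j]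
      by (intro image_eqI[of _ _ "inv \<pi> j"]) (auto simp: diff_set_def)
  qed (use \<pi> in \<open>auto simp: diff_set_def permutes_in_image\<close>)
  then show ?thesis
    using permutes_inj[OF \<pi>] by (metis inj_image_eq_iff)
qed

lemma lp_norm_of_bool:
  assumes "finite X" "B \<subseteq> X" "0 < p"
  shows "lp_norm p X (\<lambda>x. of_bool (x \<in> B)) = real (card B) powr (1 / p)"
proof -
  have "(\<Sum>x\<in>X. of_bool (x \<in> B) powr p :: real) = (\<Sum>x\<in>B. 1)"
    using assms by (intro sum.mono_neutral_cong_right) auto
  then show ?thesis by (simp add: lp_norm_def)
qed

lemma form_of_bool:
  assumes "finite X" "B \<subseteq> X"
  shows "form X w (\<lambda>x. of_bool (x \<in> B)) (\<lambda>x. of_bool (x \<in> B)) = (\<Sum>x\<in>B. \<Sum>y\<in>B. w x y)"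
proof -
  have row: "(\<Sum>y\<in>X. w x y * of_bool (x \<in> B) * of_bool (y \<in> B)) = (\<Sum>y\<in>B. w x y * of_bool (x \<in> B))" for x
    using assms by (intro sum.mono_neutral_cong_right) auto
  show ?thesis
    unfolding form_def row using assms
    by (intro sum.mono_neutral_cong_right) (auto intro: finite_subset)
qed

text \<open>For each \<open>\<pi>\<close>, precomposition turns \<open>A\<close> into a set
  \<open>B\<close> of equal size, and the form bound applies to the indicator of \<open>B\<close>.
  The averaging lemma then passes from transversals to all k-subsets.\<close>

lemma sum_pairs_at_distance_le:
  fixes U :: "'i set" and A :: "('i \<Rightarrow> nat) set"
  assumes s: "3 \<le> s" and p: "1 < p" "p \<le> 2"
    and gap: "\<And>m. 1 \<le> m \<Longrightarrow> m \<le> b \<Longrightarrow>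
      1 - 1 / (2 * real m) \<le> (p - 1) * (real s ^ m) powr (p - 2)"
    and U: "finite U" "k \<le> card U" "card U \<le> b * k"
    and A: "A \<subseteq> cube s U"
  shows "(\<Sum>J | J \<subseteq> U \<and> card J = k. \<Sum>x\<in>A. \<Sum>y\<in>A. of_bool (diff_set U x y = J))
    \<le> real (card U choose k) *
      ((real s - 1) ^ k * (real s ^ card U) powr (1 - 2 / p) * real (card A) powr (2 / p))"
proof -
  obtain \<T> where \<T>: "\<T> \<noteq> {}" "\<T> \<subseteq> {T. T \<subseteq> U \<and> card T = k}"
    and hc: "hypercontractive p (real (card \<T>) * (real s - 1) ^ k * (real s ^ card U) powr (1 - 2 / p))
      (cube s U) (\<lambda>x y. of_bool (diff_set U x y \<in> \<T>))"
    using transversal_family[OF s p gap U] by blast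
  have fin: "finite \<T>"
    using \<T>(2) by (rule finite_subset) (use U in auto)
  show ?thesis
  proof (rule sum_k_subsets_le[OF U(1) \<T>])
    fix \<pi> assume \<pi>: "\<pi> permutes U"
    define B where "B = (\<lambda>x. x \<circ> \<pi>) ` A"
    have inj: "inj_on (\<lambda>x. x \<circ> \<pi>) A"
      using permutes_surj[OF \<pi>] by (intro inj_onI) (metis surj_fun_eq)
    have B: "B \<subseteq> cube s U"
    proof
      fix z assume "z \<in> B"
      then obtain x where x: "z = x \<circ> \<pi>" "x \<in> cube s U"
        using A by (auto simp: B_def)
      then show "z \<in> cube s U"
        using \<pi> by (auto simp: PiE_iff extensional_def permutes_in_image permutes_not_in)
    qed
    have "(\<Sum>T\<in>\<T>. \<Sum>x\<in>A. \<Sum>y\<in>A. of_bool (diff_set U x y = \<pi> ` T) :: real)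
        = (\<Sum>x\<in>A. \<Sum>T\<in>\<T>. \<Sum>y\<in>A. of_bool (diff_set U x y = \<pi> ` T))"
      by (rule sum.swap)
    also have "\<dots> = (\<Sum>x\<in>A. \<Sum>y\<in>A. \<Sum>T\<in>\<T>. of_bool (diff_set U x y = \<pi> ` T))"
      by (intro sum.cong refl sum.swap)
    \<comment> \<open>A pair has only one difference set, so the sum over \<open>\<T>\<close>
      collapses to a membership indicator.\<close>
    also have "\<dots> = (\<Sum>x\<in>A. \<Sum>y\<in>A. of_bool (diff_set U (x \<circ> \<pi>) (y \<circ> \<pi>) \<in> \<T>))"
      using fin by (simp add: diff_set_comp_permutes[OF \<pi>] of_bool_def)
    also have "\<dots> = (\<Sum>x\<in>B. \<Sum>y\<in>B. of_bool (diff_set U x y \<in> \<T>))"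
      by (simp add: B_def sum.reindex[OF inj])
    also have "\<dots> = form (cube s U) (\<lambda>x y. of_bool (diff_set U x y \<in> \<T>))
        (\<lambda>x. of_bool (x \<in> B)) (\<lambda>x. of_bool (x \<in> B))"
      using U B by (simp add: form_of_bool)
    also have "\<dots> \<le> real (card \<T>) * (real s - 1) ^ k * (real s ^ card U) powr (1 - 2 / p) *
        (lp_norm p (cube s U) (\<lambda>x. of_bool (x \<in> B)) * lp_norm p (cube s U) (\<lambda>x. of_bool (x \<in> B)))"
      using hc unfolding hypercontractive_def by simp
    also have "\<dots> = real (card \<T>) *
        ((real s - 1) ^ k * (real s ^ card U) powr (1 - 2 / p) * real (card A) powr (2 / p))"
      using U B p by (simp add: lp_norm_of_bool B_def card_image[OF inj] flip: powr_add)
    finally show "(\<Sum>T\<in>\<T>. \<Sum>x\<in>A. \<Sum>y\<in>A. of_bool (diff_set U x y = \<pi> ` T)) \<le> real (card \<T>) *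
        ((real s - 1) ^ k * (real s ^ card U) powr (1 - 2 / p) * real (card A) powr (2 / p))" .
  qed
qed

section \<open>The noise probability as a normalised count of pairs\<close>

lemma prob_bind_pmf_of_set:
  assumes "finite A" "A \<noteq> {}"
  shows "measure_pmf.prob (pmf_of_set A \<bind> f) S = (\<Sum>a\<in>A. measure_pmf.prob (f a) S) / real (card A)"
proof -
  have "measure_pmf.prob (pmf_of_set A \<bind> f) S = (\<integral>a. measure_pmf.prob (f a) S \<partial>pmf_of_set A)"
    unfolding measure_pmf_bind
    by (rule measure_pmf.measure_bind[where N = "count_space UNIV"])
      (auto intro: measure_pmf_in_subprob_algebra)
  then show ?thesis
    using assms by (simp add: integral_pmf_of_set)
qed

text \<open>The default value \<open>undefined\<close> of the product agrees with extensionality of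
  the cube outside \<open>U\<close>.\<close>

lemma PiE_dflt_eq_diff_set:
  assumes x: "x \<in> cube s U" and J: "J \<subseteq> U"
  shows "PiE_dflt U undefined (\<lambda>i. if i \<in> J then {..<s} - {x i} else {x i}) = {y \<in> cube s U. diff_set U x y = J}"
proof (intro set_eqI iffI)
  fix y assume y: "y \<in> PiE_dflt U undefined (\<lambda>i. if i \<in> J then {..<s} - {x i} else {x i})"
  have "y i < s" if "i \<in> U" for i
    using y PiE_mem[OF x that] that by (cases "i \<in> J") (auto simp: PiE_dflt_def)
  moreover have "x i \<noteq> y i \<longleftrightarrow> i \<in> J" if "i \<in> U" for i
    using y that by (cases "i \<in> J") (auto simp: PiE_dflt_def)
  ultimately show "y \<in> {y \<in> cube s U. diff_set U x y = J}"
    using y J by (auto simp: PiE_iff extensional_def diff_set_def PiE_dflt_def)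
next
  fix y assume y: "y \<in> {y \<in> cube s U. diff_set U x y = J}"
  then have "i \<in> J \<longleftrightarrow> i \<in> U \<and> x i \<noteq> y i" for i
    by (auto simp: diff_set_def)
  then show "y \<in> PiE_dflt U undefined (\<lambda>i. if i \<in> J then {..<s} - {x i} else {x i})"
    using y by (auto simp: PiE_dflt_def PiE_iff extensional_def)
qed

text \<open>Given \<open>J\<close>, every chosen coordinate is forced to change, so the noise is
  uniform on the points whose difference set from \<open>x\<close> is exactly \<open>J\<close>;
  there are \<open>(s - 1) ^ k\<close> of them.\<close>

lemma prob_spherical_noise:
  assumes s: "2 \<le> s" and k: "k \<le> n" "real k = \<nu> * real n" and x: "x \<in> cube s {..<n}"
  shows "measure_pmf.prob (spherical_noise s n \<nu> x) A =
    (\<Sum>J | J \<subseteq> {..<n} \<and> card J = k. real (card (A \<inter> {y \<in> cube s {..<n}. diff_set {..<n} x y = J})))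
      / (real (n choose k) * (real s - 1) ^ k)"
proof -
  define \<J> where "\<J> = {J. J \<subseteq> {..<n} \<and> card J = k}"
  have \<J>: "{J. J \<subseteq> {..<n} \<and> real (card J) = \<nu> * real n} = \<J>"
    using k by (auto simp: \<J>_def)
  have "finite \<J>" "card \<J> = n choose k"
    using n_subsets[of "{..<n}" k] by (simp_all add: \<J>_def)
  moreover from this k have "\<J> \<noteq> {}"
    by (metis card.empty binomial_eq_0_iff not_le)
  ultimately have "measure_pmf.prob (spherical_noise s n \<nu> x) A =
    (\<Sum>J\<in>\<J>. measure_pmf.prob (Pi_pmf {..<n} undefined
       (\<lambda>i. if i \<in> J then pmf_of_set ({..<s} - {x i}) else return_pmf (x i))) A) / real (n choose k)"
    unfolding spherical_noise_def \<J> by (simp add: prob_bind_pmf_of_set)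
  also have "\<dots> = (\<Sum>J\<in>\<J>. real (card (A \<inter> {y \<in> cube s {..<n}. diff_set {..<n} x y = J})) / (real s - 1) ^ k)
      / real (n choose k)"
  proof (intro arg_cong2[where f = "(/)"] sum.cong refl)
    fix J assume J: "J \<in> \<J>"
    define F where "F = (\<lambda>i. if i \<in> J then {..<s} - {x i} else {x i})"
    have F: "finite (F i)" "F i \<noteq> {}" for i
    proof -
      have "(if x i = 0 then 1 else 0) \<in> {..<s} - {x i}"
        using s by auto
      then show "finite (F i)" "F i \<noteq> {}" by (auto simp: F_def)
    qed
    have "(\<lambda>i. if i \<in> J then pmf_of_set ({..<s} - {x i}) else return_pmf (x i)) = (\<lambda>i. pmf_of_set (F i))"
      by (auto simp: F_def fun_eq_iff pmf_of_set_singleton)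
    then have "Pi_pmf {..<n} undefined (\<lambda>i. if i \<in> J then pmf_of_set ({..<s} - {x i}) else return_pmf (x i))
        = pmf_of_set (PiE_dflt {..<n} undefined F)"
      using F by (simp add: Pi_pmf_of_set)
    moreover have "PiE_dflt {..<n} undefined F = {y \<in> cube s {..<n}. diff_set {..<n} x y = J}"
      using PiE_dflt_eq_diff_set[OF x] J by (simp add: F_def \<J>_def)
    moreover have card: "real (card (PiE_dflt {..<n} undefined F)) = (real s - 1) ^ k"
    proof -
      have "card (PiE_dflt {..<n} undefined F) = (\<Prod>i<n. card (F i))"
        using F by (simp add: card_PiE_dflt)
      \<comment> \<open>Each \<open>x i\<close> lies in the alphabet, so excluding it removes
        exactly one value.\<close>
      also have "\<dots> = (\<Prod>i<n. if i \<in> J then s - 1 else 1)"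
        using x by (intro prod.cong) (auto simp: F_def PiE_iff)
      also have "\<dots> = (\<Prod>i\<in>J. s - 1)"
        using J by (intro prod.mono_neutral_cong_right) (auto simp: \<J>_def)
      finally show ?thesis using J s by (simp add: \<J>_def of_nat_diff)
    qed
    moreover have "finite (PiE_dflt {..<n} undefined F)" "PiE_dflt {..<n} undefined F \<noteq> {}"
    proof -
      have "card (PiE_dflt {..<n} undefined F) \<noteq> 0"
        using card s by (intro notI) simp
      then show "finite (PiE_dflt {..<n} undefined F)" "PiE_dflt {..<n} undefined F \<noteq> {}"
        using card.infinite by force+
    qed
    ultimately show "measure_pmf.prob (Pi_pmf {..<n} undefined
       (\<lambda>i. if i \<in> J then pmf_of_set ({..<s} - {x i}) else return_pmf (x i))) A
      = real (card (A \<inter> {y \<in> cube s {..<n}. diff_set {..<n} x y = J})) / (real s - 1) ^ k"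
      by (simp add: measure_pmf_of_set Int_commute)
  qed
  finally show ?thesis
    by (simp add: \<J>_def sum_divide_distrib mult.commute)
qed

lemma prob_noisy_pair:
  assumes s: "2 \<le> s" and k: "k \<le> n" "real k = \<nu> * real n" and A: "A \<subseteq> cube s {..<n}"
  shows "measure_pmf.prob (noisy_pair s n \<nu>) {(x, y). x \<in> A \<and> y \<in> A} =
    (\<Sum>J | J \<subseteq> {..<n} \<and> card J = k. \<Sum>x\<in>A. \<Sum>y\<in>A. of_bool (diff_set {..<n} x y = J))
      / (real s ^ n * (real (n choose k) * (real s - 1) ^ k))"
proof -
  define D where "D = real (n choose k) * (real s - 1) ^ k"
  have ne: "cube s {..<n} \<noteq> {}"
    using s card_cube[of "{..<n}" s] by auto
  have fin: "finite A"
    using A finite_subset by fastforce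
  have "measure_pmf.prob (noisy_pair s n \<nu>) {(x, y). x \<in> A \<and> y \<in> A}
      = (\<Sum>x\<in>cube s {..<n}. measure_pmf.prob (spherical_noise s n \<nu> x) {y. x \<in> A \<and> y \<in> A}) / real s ^ n"
    unfolding noisy_pair_def Zs_pow_def using ne
    by (simp add: prob_bind_pmf_of_set card_cube vimage_def flip: map_pmf_def)
  also have "(\<Sum>x\<in>cube s {..<n}. measure_pmf.prob (spherical_noise s n \<nu> x) {y. x \<in> A \<and> y \<in> A})
      = (\<Sum>x\<in>A. measure_pmf.prob (spherical_noise s n \<nu> x) A)"
    using A by (intro sum.mono_neutral_cong_right) auto
  also have "\<dots> = (\<Sum>x\<in>A. (\<Sum>J | J \<subseteq> {..<n} \<and> card J = k. \<Sum>y\<in>A. of_bool (diff_set {..<n} x y = J)) / D)"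
  proof (intro sum.cong refl)
    fix x assume "x \<in> A"
    moreover have "real (card (A \<inter> {y \<in> cube s {..<n}. diff_set {..<n} x y = J}))
        = (\<Sum>y\<in>A. of_bool (diff_set {..<n} x y = J))" for J
    proof -
      have "A \<inter> {y \<in> cube s {..<n}. diff_set {..<n} x y = J} = {y \<in> A. diff_set {..<n} x y = J}"
        using A by auto
      then show ?thesis
        using fin by (simp add: of_bool_def sum.If_cases Int_def)
    qed
    ultimately show "measure_pmf.prob (spherical_noise s n \<nu> x) A
        = (\<Sum>J | J \<subseteq> {..<n} \<and> card J = k. \<Sum>y\<in>A. of_bool (diff_set {..<n} x y = J)) / D"
      using A by (subst prob_spherical_noise[OF s k]) (auto simp: D_def)
  qed
  also have "\<dots> = (\<Sum>J | J \<subseteq> {..<n} \<and> card J = k. \<Sum>x\<in>A. \<Sum>y\<in>A. of_bool (diff_set {..<n} x y = J)) / D"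
    unfolding sum_divide_distrib[symmetric] by (rule arg_cong[OF sum.swap])
  finally show ?thesis
    by (simp add: D_def)
qed

text \<open>With \<open>\<eta> = 2 - p\<close>, at most \<open>2 * lam\<close>, the choice of
  \<open>lam\<close> gives \<open>\<eta> * m * ln s \<le> 64 / 2 ^ 14 = 1 / 256\<close>. The right
  side is then at least \<open>(1 - 2 / 2 ^ 14) * (1 - 1 / 256)\<close>, above the worst left side
  \<open>1 - 1 / 64\<close>, reached at \<open>m = 32\<close>.\<close>

lemma exponent_gap:
  fixes s m :: nat and lam :: real
  assumes s: "3 \<le> s" and m: "1 \<le> m" "m \<le> 32" and lam: "lam = 1 / (2 ^ 14 * ln (real s))"
  shows "1 - 1 / (2 * real m) \<le> (2 / (1 + lam) - 1) * (real s ^ m) powr (2 / (1 + lam) - 2)"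
proof -
  have "exp 1 \<le> real s"
    using exp_le s by linarith
  then have ln: "1 \<le> ln (real s)"
    using s by (subst ln_ge_iff) auto
  have lam_pos: "0 < lam" and lam_le: "lam \<le> 1 / 2 ^ 14"
    using ln by (simp_all add: lam field_simps)
  define \<eta> where "\<eta> = 2 - 2 / (1 + lam)"
  have \<eta>: "\<eta> = 2 * lam / (1 + lam)"
    using lam_pos by (simp add: \<eta>_def field_simps)
  have \<eta>_le: "\<eta> \<le> 2 * lam" and \<eta>_pos: "0 \<le> \<eta>"
    using lam_pos by (simp_all add: \<eta> field_simps)
  have "\<eta> * (real m * ln (real s)) \<le> 2 * lam * (32 * ln (real s))"
    using \<eta>_le \<eta>_pos m ln lam_pos by (intro mult_mono) auto
  also have "\<dots> = 1 / 256"
    using ln by (simp add: lam)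
  finally have "1 - 1 / 256 \<le> 1 - \<eta> * (real m * ln (real s))"
    by simp
  also have "\<dots> \<le> exp (- (\<eta> * (real m * ln (real s))))"
    using exp_ge_add_one_self[of "- (\<eta> * (real m * ln (real s)))"] by simp
  also have "\<dots> = (real s ^ m) powr (- \<eta>)"
    using s by (simp add: powr_def ln_realpow)
  finally have "(1 - 1 / 256) \<le> (real s ^ m) powr (- \<eta>)" .
  then have "(1 - 2 / 2 ^ 14) * (1 - 1 / 256) \<le> (1 - \<eta>) * (real s ^ m) powr (- \<eta>)"
    using \<eta>_le lam_le by (intro mult_mono) auto
  moreover have "1 - 1 / (2 * real m) \<le> 1 - 1 / 64"
    using m by (simp add: field_simps)
  ultimately show ?thesis
    by (simp add: \<eta>_def)
qed

theorem theorem6p4: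
  fixes s n :: nat and A :: "(nat \<Rightarrow> nat) set" and \<delta> \<nu> lam :: real
  assumes "s \<ge> 3"
    and "A \<subseteq> Zs_pow s n"
    and "measure_pmf.prob (pmf_of_set (Zs_pow s n)) A = \<delta>"
    and "1 / 32 \<le> \<nu>" and "\<nu> \<le> 1"
    and "\<nu> * real n \<in> \<int>"
    and "lam = 1 / (2 ^ 14 * ln (real s))"
  shows "measure_pmf.prob (noisy_pair s n \<nu>) {(x, y). x \<in> A \<and> y \<in> A} \<le> 2 * \<delta> powr (1 + lam)"
proof -
  have A: "A \<subseteq> cube s {..<n}"
    using assms(2) by (simp add: Zs_pow_def)
  have "0 \<le> \<nu> * real n"
    using assms(4) by simp
  then obtain k :: nat where k: "real k = \<nu> * real n"
    using assms(6) by (metis Ints_cases of_int_0_le_iff of_int_of_nat_eq zero_le_imp_eq_int)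
  \<comment> \<open>The two bounds on \<open>\<nu>\<close> are exactly what permits \<open>k\<close>
    nonempty blocks of size at most 32.\<close>
  have "real k \<le> 1 * real n" "1 / 32 * real n \<le> real k"
    unfolding k using assms(4,5) by (intro mult_right_mono; simp)+
  then have kn: "k \<le> n" "n \<le> 32 * k"
    by simp_all
  have ln: "0 < ln (real s)"
    using assms(1) by simp
  have lam: "0 < lam"
    using ln assms(7) by simp
  define p where "p = 2 / (1 + lam)"
  have "exp 1 \<le> real s"
    using exp_le assms(1) by linarith
  then have "1 \<le> ln (real s)"
    using assms(1) by (subst ln_ge_iff) auto
  then have "lam < 1"
    by (simp add: assms(7) field_simps)
  then have p: "1 < p" "p \<le> 2"
    using lam by (simp_all add: p_def field_simps)
  have pe: "2 / p = 1 + lam"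
    using lam by (simp add: p_def)
  define N C where "N = real s ^ n" and "C = real (n choose k) * (real s - 1) ^ k"
  have pos: "0 < N" "0 < C"
    using assms(1) kn by (simp_all add: N_def C_def)
  have ne: "cube s {..<n} \<noteq> {}"
    using assms(1) card_cube[of "{..<n}" s] by auto
  have \<delta>: "\<delta> = real (card A) / N"
    using assms(3) A ne
    by (simp add: Zs_pow_def measure_pmf_of_set card_cube N_def Int_absorb1)
  have "measure_pmf.prob (noisy_pair s n \<nu>) {(x, y). x \<in> A \<and> y \<in> A}
      = (\<Sum>J | J \<subseteq> {..<n} \<and> card J = k. \<Sum>x\<in>A. \<Sum>y\<in>A. of_bool (diff_set {..<n} x y = J)) / (N * C)"
    using prob_noisy_pair[OF _ kn(1) k A] assms(1) by (simp add: N_def C_def)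
  \<comment> \<open>Since \<open>2 / p = 1 + lam\<close>, the normalising power
    \<open>1 - 2 / p\<close> is \<open>- lam\<close>; with the \<open>N\<close> in the denominator
    it yields the \<open>N powr (1 + lam)\<close> hidden in
    \<open>\<delta> powr (1 + lam)\<close>.\<close>
  also have "\<dots> \<le> C * N powr (- lam) * real (card A) powr (1 + lam) / (N * C)"
    using sum_pairs_at_distance_le[where b = 32 and k = k,
        OF assms(1) p exponent_gap[OF assms(1) _ _ assms(7), folded p_def] _ _ _ A]
      kn pos assms(1)
    by (intro divide_right_mono) (simp_all add: pe N_def C_def mult_ac)
  also have "\<dots> = \<delta> powr (1 + lam)"
  proof -
    have "N powr (1 + lam) = N * N powr lam"
      using pos by (simp add: powr_add)
    then show ?thesis
      using pos by (simp add: \<delta> powr_divide powr_minus divide_simps)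
  qed
  also have "\<dots> \<le> 2 * \<delta> powr (1 + lam)"
    by simp
  finally show ?thesis .
qed

end
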